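(* Let $G_1,\dots,G_m$ be cumulative distribution functions and let $H_{G_1,\dots,G_m}$ be a cumulative distribution function generated from $G_1,\dots,G_m$ by Form A (respectively, by Form B), as defined in the context. Then $S_{H_{G_1,\dots,G_m}}\subset\bigcup_{j=1}^m S_{G_j}$.
   Context: A cumulative distribution function (cdf) is a non-decreasing right continuous $F:\mathbb{R}\to\mathbb{R}$ with limits $0$ at $-\infty$ and $1$ at $+\infty$. The support of a cdf $F$ is $S_F=\{x\in\mathbb{R}:F(x)-F(x-\varepsilon)>0\ \ \forall\varepsilon>0\}$. Conventions: $F(-\infty)=0$, $F(+\infty)=1$, $\int_a^b dF=F(b)-F(a)$ for $a,b\in\mathbb{R}\cup\{\pm\infty\}$; sup, inf and continuity for extended-real-valued functions are in $\mathbb{R}\cup\{\pm\infty\}$. A function $h$ on $[0,1]^m$ is right continuous if $h(s)\to h(t)$ as $s\to t$ with $s_i\ge t_i$ for all $i$. For cdfs $G_1,\dots,G_m$ ($m\ge1$) write $h(.)(x)=h(G_1(x),\dots,G_m(x))$, $\mathbf0=(0,\dots,0)$, $\mathbf1=(1,\dots,1)$. Say $f:\mathbb{R}\to\mathbb{R}\cup\{\pm\infty\}$ is compatible with a cdf $F$ if for every $x_0$ such that $f(x_0)$ is a discontinuity point of $F$, $f$ is continuous at $x_0$ and constant on some $[x_0,x_0+\delta)$, $\delta>0$. **Form A.** Data: $n\ge1$; $F:\mathbb{R}\to\mathbb{R}$; monotonic right continuous $\mathcal U,\vartheta:[0,1]^m\to\mathbb{R}$ and $\mu_j,\ell_j,\nu_j,m_j:[0,1]^m\to\mathbb{R}\cup\{\pm\infty\}$,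 $1\le j\le n$, with: (1) $F$ a cdf, $\mathcal U,\vartheta\ge0$; (2) $\mu_j,m_j,\mathcal U$ non-decreasing, $\ell_j,\nu_j,\vartheta$ non-increasing in all variables; (3) if $\mathcal U(\mathbf0)\ne\vartheta(\mathbf0)$, then [$\mathcal U(\mathbf0)=0$ or $\mu_j(\mathbf0)=\ell_j(\mathbf0)\ \forall j$] and [$\vartheta(\mathbf0)=0$ or $m_j(\mathbf0)=\nu_j(\mathbf0)\ \forall j$]; (4) if $\mathcal U(\mathbf0)=\vartheta(\mathbf0)\ne0$, then $\mu_j(\mathbf0)=\nu_j(\mathbf0)$ and $m_j(\mathbf0)=\ell_j(\mathbf0)\ \forall j$; (5) $\ell_j(\mathbf0)\le\mu_j(\mathbf0)\ \forall j$, and if $\vartheta(\mathbf0)\ne0$ then $m_j(\mathbf1)\le\nu_j(\mathbf1)\ \forall j$; (6) $\mu_n(\mathbf1)\ge\sup\{x:F(x)<1\}$ and $\ell_1(\mathbf1)\le\inf\{x:F(x)>0\}$; (7) $\mathcal U(\mathbf1)=1$; (8) $\vartheta(\mathbf1)=0$ or $\nu_j(\mathbf1)=m_j(\mathbf1)\ \forall j$; (9) $\mu_j(\mathbf1)=\ell_{j+1}(\mathbf1)$ for $1\le j\le n-1$; (10) $F$ is continuous or all functions $x\mapsto\ell_j(.)(x)$, $x\mapsto\nu_j(.)(x)$ are compatible with $F$; moreover $F$ has no discontinuity at any of the values of $\ell_j,\mu_j,m_j,\nu_j$ at $\mathbf0$ and $\mathbf1$. The generated function is $$H_{G_1,\dots,G_m}(x)=\mathcal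 U(.)(x)\sum_{j=1}^n\int_{\ell_j(.)(x)}^{\mu_j(.)(x)}dF(t)-\vartheta(.)(x)\sum_{j=1}^n\int_{m_j(.)(x)}^{\nu_j(.)(x)}dF(t).$$ **Form B.** Data: $\eta\ge1$; $\varphi:\mathbb{R}\to\mathbb{R}$; monotonic right continuous $\mathcal U,\vartheta:[0,1]^m\to\mathbb{R}$ and $\mu_j,\ell_j,\nu_j,m_j:[0,1]^m\to\mathbb{R}\cup\{\pm\infty\}$, $1\le j\le\eta$, with: (1) $\varphi$ a cdf, $\mathcal U,\vartheta\ge0$; (2) $\mu_j,m_j,\mathcal U$ non-decreasing, $\ell_j,\nu_j,\vartheta$ non-increasing in all variables; (3) if $\mathcal U(\mathbf1)\ne\vartheta(\mathbf1)$, then [$\vartheta(\mathbf1)=0$ or $m_j(\mathbf1)=\nu_j(\mathbf1)\ \forall j$] and [$\mathcal U(\mathbf1)=0$ or $\ell_j(\mathbf1)=\mu_j(\mathbf1)\ \forall j$]; (4) if $\mathcal U(\mathbf1)=\vartheta(\mathbf1)\ne0$, then $\mu_j(\mathbf1)=\nu_j(\mathbf1)$ and $m_j(\mathbf1)=\ell_j(\mathbf1)\ \forall j$; (5) $m_j(\mathbf1)\le\nu_j(\mathbf1)\ \forall j$, and if $\mathcal U(\mathbf1)\ne0$ then $\ell_j(\mathbf0)\le\mu_j(\mathbf0)\ \forall j$; (6) $\nu_\eta(\mathbf0)\ge\sup\{x:\varphi(x)<1\}$ and $m_1(\mathbf0)\le\inf\{x:\varphi(x)>0\}$; (7) $\vartheta(\mathbf0)=1$;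 (8) $\mathcal U(\mathbf0)=0$ or $\ell_j(\mathbf0)=\mu_j(\mathbf0)\ \forall j$; (9) $\nu_j(\mathbf0)=m_{j+1}(\mathbf0)$ for $1\le j\le\eta-1$; (10) $\varphi$ is continuous or all functions $x\mapsto\ell_j(.)(x)$, $x\mapsto\nu_j(.)(x)$ are compatible with $\varphi$; moreover $\varphi$ has no discontinuity at any of the values of $\ell_j,\mu_j,m_j,\nu_j$ at $\mathbf0$ and $\mathbf1$. The generated function is $$H_{G_1,\dots,G_m}(x)=1-\vartheta(.)(x)\sum_{j=1}^\eta\int_{m_j(.)(x)}^{\nu_j(.)(x)}d\varphi(t)+\mathcal U(.)(x)\sum_{j=1}^\eta\int_{\ell_j(.)(x)}^{\mu_j(.)(x)}d\varphi(t).$$ *)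

theory Defs
  imports "HOL-Analysis.Analysis"
begin

definition is_cdf :: "(real \<Rightarrow> real) \<Rightarrow> bool" where
  "is_cdf F \<longleftrightarrow> mono F \<and> (\<forall>x. continuous (at_right x) F) \<and>
     (F \<longlongrightarrow> 0) at_bot \<and> (F \<longlongrightarrow> 1) at_top"

definition cdf_support :: "(real \<Rightarrow> real) \<Rightarrow> real set" where
  "cdf_support F = {x. \<forall>\<epsilon>>0. F x - F (x - \<epsilon>) > 0}"

definition cdf_ext :: "(real \<Rightarrow> real) \<Rightarrow> ereal \<Rightarrow> real" where
  "cdf_ext F y = (case y of ereal x \<Rightarrow> F x | PInfty \<Rightarrow> 1 | MInfty \<Rightarrow> 0)"

definition cdf_integral :: "(real \<Rightarrow> real) \<Rightarrow> ereal \<Rightarrow> ereal \<Rightarrow> real" where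
  "cdf_integral F a b = cdf_ext F b - cdf_ext F a"

text \<open>The cube is \<open>{0..1}\<close> in the componentwise order of \<open>real ^ 'm\<close>, and \<open>0\<close>, \<open>1\<close> are the
  constant vectors. Functions on the cube are total functions; only their values on the cube
  are constrained or used. Accordingly, \<open>mono_on {0..1}\<close> is monotonicity in every variable.\<close>

definition right_continuous_cube :: "(real ^ 'm \<Rightarrow> 'b::topological_space) \<Rightarrow> bool" where
  "right_continuous_cube h \<longleftrightarrow>
     (\<forall>t\<in>{0..1}. (h \<longlongrightarrow> h t) (at t within {s\<in>{0..1}. \<forall>i. t $ i \<le> s $ i}))"

definition at_cdfs :: "(real ^ 'm \<Rightarrow> 'b) \<Rightarrow> ('m \<Rightarrow> real \<Rightarrow> real) \<Rightarrow> real \<Rightarrow> 'b" where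
  "at_cdfs h G x = h (\<chi> i. G i x)"

text \<open>Infinite values are never discontinuity points: the extension \<open>cdf_ext F\<close> of a cdf \<open>F\<close> is
  continuous at both infinities.\<close>

definition discontinuity_point :: "(real \<Rightarrow> real) \<Rightarrow> ereal \<Rightarrow> bool" where
  "discontinuity_point F y \<longleftrightarrow> (\<exists>r. y = ereal r \<and> \<not> isCont F r)"

definition compatible :: "(real \<Rightarrow> ereal) \<Rightarrow> (real \<Rightarrow> real) \<Rightarrow> bool" where
  "compatible f F \<longleftrightarrow>
     (\<forall>x0. discontinuity_point F (f x0) \<longrightarrow>
        isCont f x0 \<and> (\<exists>\<delta>>0. \<forall>x\<in>{x0..<x0 + \<delta>}. f x = f x0))"

locale generating_data =
  fixes G :: "'m::finite \<Rightarrow> real \<Rightarrow> real"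
    and n :: nat
    and F :: "real \<Rightarrow> real"
    and U \<theta> :: "real ^ 'm \<Rightarrow> real"
    and \<mu> l \<nu> m :: "nat \<Rightarrow> real ^ 'm \<Rightarrow> ereal"
  assumes n_pos: "n \<ge> 1"
    and right_continuous:
      "right_continuous_cube U" "right_continuous_cube \<theta>"
      "\<And>j. j \<in> {1..n} \<Longrightarrow> right_continuous_cube (\<mu> j)"
      "\<And>j. j \<in> {1..n} \<Longrightarrow> right_continuous_cube (l j)"
      "\<And>j. j \<in> {1..n} \<Longrightarrow> right_continuous_cube (\<nu> j)"
      "\<And>j. j \<in> {1..n} \<Longrightarrow> right_continuous_cube (m j)"
    and cdf: "is_cdf F"
    and nonneg: "\<And>t. t \<in> {0..1} \<Longrightarrow> U t \<ge> 0" "\<And>t. t \<in> {0..1} \<Longrightarrow> \<theta> t \<ge> 0"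
    and non_decreasing:
      "mono_on {0..1} U"
      "\<And>j. j \<in> {1..n} \<Longrightarrow> mono_on {0..1} (\<mu> j)"
      "\<And>j. j \<in> {1..n} \<Longrightarrow> mono_on {0..1} (m j)"
    and non_increasing:
      "antimono_on {0..1} \<theta>"
      "\<And>j. j \<in> {1..n} \<Longrightarrow> antimono_on {0..1} (l j)"
      "\<And>j. j \<in> {1..n} \<Longrightarrow> antimono_on {0..1} (\<nu> j)"
    and continuous_or_compatible:
      "continuous_on UNIV F \<or>
       (\<forall>j\<in>{1..n}. compatible (at_cdfs (l j) G) F \<and> compatible (at_cdfs (\<nu> j) G) F)"
    and no_discontinuity:
      "\<And>j t h. \<lbrakk>j \<in> {1..n}; t \<in> {0, 1}; h \<in> {l j, \<mu> j, m j, \<nu> j}\<rbrakk>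
         \<Longrightarrow> \<not> discontinuity_point F (h t)"

locale form_A = generating_data +
  assumes distinct: "U 0 \<noteq> \<theta> 0 \<Longrightarrow>
        (U 0 = 0 \<or> (\<forall>j\<in>{1..n}. \<mu> j 0 = l j 0)) \<and>
        (\<theta> 0 = 0 \<or> (\<forall>j\<in>{1..n}. m j 0 = \<nu> j 0))"
    and equal: "U 0 = \<theta> 0 \<and> \<theta> 0 \<noteq> 0 \<Longrightarrow> \<forall>j\<in>{1..n}. \<mu> j 0 = \<nu> j 0 \<and> m j 0 = l j 0"
    and ordered: "\<forall>j\<in>{1..n}. l j 0 \<le> \<mu> j 0"
      "\<theta> 0 \<noteq> 0 \<Longrightarrow> \<forall>j\<in>{1..n}. m j 1 \<le> \<nu> j 1"
    and covering: "\<mu> n 1 \<ge> Sup (ereal ` {x. F x < 1})" "l 1 1 \<le> Inf (ereal ` {x. F x > 0})"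
    and one: "U 1 = 1"
    and vanishing: "\<theta> 1 = 0 \<or> (\<forall>j\<in>{1..n}. \<nu> j 1 = m j 1)"
    and chained: "\<forall>j\<in>{1..n - 1}. \<mu> j 1 = l (j + 1) 1"

locale form_B = generating_data +
  assumes distinct: "U 1 \<noteq> \<theta> 1 \<Longrightarrow>
        (\<theta> 1 = 0 \<or> (\<forall>j\<in>{1..n}. m j 1 = \<nu> j 1)) \<and>
        (U 1 = 0 \<or> (\<forall>j\<in>{1..n}. l j 1 = \<mu> j 1))"
    and equal: "U 1 = \<theta> 1 \<and> \<theta> 1 \<noteq> 0 \<Longrightarrow> \<forall>j\<in>{1..n}. \<mu> j 1 = \<nu> j 1 \<and> m j 1 = l j 1"
    and ordered: "\<forall>j\<in>{1..n}. m j 1 \<le> \<nu> j 1"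
      "U 1 \<noteq> 0 \<Longrightarrow> \<forall>j\<in>{1..n}. l j 0 \<le> \<mu> j 0"
    and covering: "\<nu> n 0 \<ge> Sup (ereal ` {x. F x < 1})" "m 1 0 \<le> Inf (ereal ` {x. F x > 0})"
    and one: "\<theta> 0 = 1"
    and vanishing: "U 0 = 0 \<or> (\<forall>j\<in>{1..n}. l j 0 = \<mu> j 0)"
    and chained: "\<forall>j\<in>{1..n - 1}. \<nu> j 0 = m (j + 1) 0"

definition generated_by_A :: "('m::finite \<Rightarrow> real \<Rightarrow> real) \<Rightarrow> (real \<Rightarrow> real) \<Rightarrow> bool" where
  "generated_by_A G H \<longleftrightarrow>
     (\<exists>n F U \<theta> \<mu> l \<nu> m. form_A G n F U \<theta> \<mu> l \<nu> m \<and>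
        (\<forall>x. H x =
            at_cdfs U G x * (\<Sum>j=1..n. cdf_integral F (at_cdfs (l j) G x) (at_cdfs (\<mu> j) G x))
          - at_cdfs \<theta> G x * (\<Sum>j=1..n. cdf_integral F (at_cdfs (m j) G x) (at_cdfs (\<nu> j) G x))))"

definition generated_by_B :: "('m::finite \<Rightarrow> real \<Rightarrow> real) \<Rightarrow> (real \<Rightarrow> real) \<Rightarrow> bool" where
  "generated_by_B G H \<longleftrightarrow>
     (\<exists>n F U \<theta> \<mu> l \<nu> m. form_B G n F U \<theta> \<mu> l \<nu> m \<and>
        (\<forall>x. H x =
          1 - at_cdfs \<theta> G x * (\<Sum>j=1..n. cdf_integral F (at_cdfs (m j) G x) (at_cdfs (\<nu> j) G x))
            + at_cdfs U G x * (\<Sum>j=1..n. cdf_integral F (at_cdfs (l j) G x) (at_cdfs (\<mu> j) G x))))"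

end

(* H x depends on x only through the vector (G i x). Off the union of the supports every G i is
   constant on some interval [x - e i, x]; there are finitely many i, so all the G i, and hence H,
   are constant on a common one. *)
theory Submission
  imports Defs
begin

text \<open>A failing \<epsilon> = \<open>e\<close> in the support condition gives
  \<open>F x \<le> F (x - e)\<close>; monotonicity then squeezes \<open>F y\<close> between these
  two values.\<close>

lemma eventually_constant_left_of_non_support:
  assumes "mono F" "x \<notin> cdf_support F"
  shows "\<forall>\<^sub>F y in at_left x. F y = F x"
proof -
  obtain e where "e > 0" "F x \<le> F (x - e)"
    using assms(2) by (force simp: cdf_support_def)
  have "F y = F x" if "x - e < y" "y < x" for y
    using monoD[OF assms(1), of "x - e" y] monoD[OF assms(1), of y x] \<open>F x \<le> F (x - e)\<close> that
    by linarith
  then show ?thesis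
    using \<open>e > 0\<close> unfolding eventually_at_left_field by (intro exI[of _ "x - e"]) simp
qed

text \<open>Stated for any \<open>H\<close> that factors through the vector of the
  \<open>G i x\<close>; both forms do, so one argument serves A and B.\<close>

lemma cdf_support_subset_Union:
  fixes G :: "'m::finite \<Rightarrow> real \<Rightarrow> real"
  assumes "\<And>i. mono (G i)" and H: "\<And>x y. (\<And>i. G i x = G i y) \<Longrightarrow> H x = H y"
  shows "cdf_support H \<subseteq> (\<Union>i. cdf_support (G i))"
proof (rule ccontr)
  assume "\<not> ?thesis"
  then obtain x where x: "x \<in> cdf_support H" "\<And>i. x \<notin> cdf_support (G i)"
    by auto
  have "\<forall>\<^sub>F y in at_left x. \<forall>i. G i y = G i x"
    using assms(1) x(2) by (intro eventually_all_finite eventually_constant_left_of_non_support)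
  then obtain b where b: "b < x" "\<And>y i. b < y \<Longrightarrow> y < x \<Longrightarrow> G i y = G i x"
    unfolding eventually_at_left_field by blast
  obtain y where "b < y" "y < x"
    using dense b(1) by blast
  moreover from this have "H y = H x"
    by (intro H b(2))
  \<comment> \<open>With \<epsilon> = \<open>x - y\<close>, the support condition at
    \<open>x\<close> would give \<open>H x - H y > 0\<close>.\<close>
  ultimately show False
    using x(1) by (auto simp: cdf_support_def dest!: spec[of _ "x - y"])
qed

lemma at_cdfs_cong:
  assumes "\<And>i. G i x = G i y"
  shows "at_cdfs h G x = at_cdfs h G y"
  using assms by (simp add: at_cdfs_def)

theorem theorem3:
  fixes G :: "'m::finite \<Rightarrow> real \<Rightarrow> real" and H :: "real \<Rightarrow> real"
  assumes "\<And>i. is_cdf (G i)"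
    and "is_cdf H"
    and "generated_by_A G H \<or> generated_by_B G H"
  shows "cdf_support H \<subseteq> (\<Union>i. cdf_support (G i))"
proof (rule cdf_support_subset_Union)
  show "mono (G i)" for i
    using assms(1)[of i] by (simp add: is_cdf_def)
  fix x y
  assume "\<And>i. G i x = G i y"
  \<comment> \<open>\<open>h\<close> stays schematic, its type included, so one rule moves both the
    real coefficients and the \<open>ereal\<close> limits of integration from \<open>x\<close> to
    \<open>y\<close>.\<close>
  note cong = at_cdfs_cong[of G, OF this]
  show "H x = H y"
    using assms(3)
  proof
    assume "generated_by_A G H"
    \<comment> \<open>The formula for \<open>H\<close> becomes a premise that rewrites both
      \<open>H x\<close> and \<open>H y\<close>.\<close>
    then show ?thesis
      unfolding generated_by_A_def by (elim exE conjE) (simp only: cong)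
  next
    assume "generated_by_B G H"
    then show ?thesis
      unfolding generated_by_B_def by (elim exE conjE) (simp only: cong)
  qed
qed

end
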